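(* In the matching market with preference uncertainty described in the context, let $\pi$ be a signal profile. For all $b,b'\in\mathbb{R}^n_{\ge0}$ with $b\ge b'$ (componentwise), $U_k(\pi,b)\ge U_k(\pi,b')$ for all $1\le k\le t$. That is, all students weakly prefer the higher cutoff under each signal profile.
   Context: Market. $S=\{s_1,\dots,s_t\}$ is a finite set of students and $P=\{p_1,\dots,p_n\}$ a finite set of programs. Each program $p$ has a strict priority (strict linear order) $\mathcal{R}_p$ over $S$ ($s\,\mathcal{R}_p\,s'$ means $s$ has higher priority than $s'$). $\Omega$ is a finite set of states; in each state each student has a strict preference over $P$. $\psi\in\Delta(\Omega)$ is a common prior. Student $s_k$ has utility $u_k:P\times\Omega\to\mathbb{R}$ with $u_k(p,\omega)>u_k(p',\omega)$ iff $s_k$ strictly prefers $p$ to $p'$ in state $\omega$. Signals. A signal $\pi_k$ of $s_k$ consists of a finite set $I_k$ of realizations and distributions $\pi_k(\cdot|\omega)\in\Delta(I_k)$, $\omega\in\Omega$. Realization $i_k$ induces the Bayesian posterior $\mu_k^{i_k}(\omega)=\pi_k(i_k|\omega)\psi(\omega)/\sum_{\omega'}\pi_k(i_k|\omega')\psi(\omega')$. A signal profile is $\pi=(\pi_k)_{1\le k\le t}$. Standing assumption: no two distinct programs give a student the same expected payoff under the prior or under any posterior. Cutoffs. The rank of $s_k$ at $p$ is $r_p(s_k)=1+|\{s\in S: s\,\mathcal{R}_p\,s_k\}|$. A deterministic cutoff is $\bar b\in\bar B=\mathbb{N}^n$ (with $0\in\mathbb{N}$), and $C(s_k,\bar b)=\{p\in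 P: r_p(s_k)\le\bar b_p\}$ is the induced choice set. For an ex-ante cutoff $b\in\mathbb{R}^n_{\ge0}$ let $\phi^b_p(m)=\max\{0,1-|b_p-m|\}$ for $m\in\mathbb{N}$ and $\phi^b(\bar b)=\prod_{p\in P}\phi^b_p(\bar b_p)$, a probability distribution on $\bar B$. Decision rule. For $C\subseteq P$ (nonempty), $\sigma_k(C,i_k)=\arg\max_{p\in C}\sum_{\omega}\mu_k^{i_k}(\omega)u_k(p,\omega)$. Welfare. $U_k(\pi,b)=\sum_{\bar b,i_k,\omega}\phi^b(\bar b)\,\psi(\omega)\,\pi_k(i_k|\omega)\,u_k(\sigma_k(C(s_k,\bar b),i_k),\omega)$, where cutoffs $\bar b$ with $C(s_k,\bar b)=\emptyset$ contribute no term to the sum.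
   Formalization: Added: if student s_k has an empty choice set with positive probability under b', every program must have non-negative expected payoff for s_k under the prior; otherwise the claim fails (one student, program and state, u=-1, b'=0, b=1 gives U(b)=-1<0=U(b')). *)

theory Defs
  imports "HOL-Probability.Probability"
begin

text \<open>
  Students, programs and states are the elements of finite types \<open>'s\<close>, \<open>'p\<close>, \<open>'w\<close>, so
  \<open>'p \<Rightarrow> real\<close> and \<open>'p \<Rightarrow> nat\<close> play the roles of $\mathbb{R}^n$ and $\mathbb{N}^n$.
  \<open>(s, s') \<in> prio p\<close> means that \<open>s\<close> has higher priority than \<open>s'\<close> at \<open>p\<close>;
  \<open>(p, p') \<in> pref k w\<close> means that \<open>k\<close> strictly prefers \<open>p\<close> to \<open>p'\<close> in state \<open>w\<close>.
\<close>

locale matching_market =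
  fixes prio :: "'p::finite \<Rightarrow> ('s::finite \<times> 's) set"
    and pref :: "'s \<Rightarrow> 'w::finite \<Rightarrow> ('p \<times> 'p) set"
    and u :: "'s \<Rightarrow> 'p \<Rightarrow> 'w \<Rightarrow> real"
  assumes priority: "strict_linear_order_on UNIV (prio p)"
    and preference: "strict_linear_order_on UNIV (pref k w)"
    and utility: "u k p w > u k p' w \<longleftrightarrow> (p, p') \<in> pref k w"

text \<open>
  The realization sets \<open>I k\<close> of the different students live in one common type \<open>'i\<close>.
\<close>

definition signal_profile :: "('s \<Rightarrow> 'i set) \<Rightarrow> ('s \<Rightarrow> 'w \<Rightarrow> 'i pmf) \<Rightarrow> bool" where
  "signal_profile I sig \<longleftrightarrow> (\<forall>k. finite (I k) \<and> (\<forall>w. set_pmf (sig k w) \<subseteq> I k))"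

definition posterior ::
    "'w::finite pmf \<Rightarrow> ('s \<Rightarrow> 'w \<Rightarrow> 'i pmf) \<Rightarrow> 's \<Rightarrow> 'i \<Rightarrow> 'w \<Rightarrow> real" where
  "posterior \<psi> sig k i w =
     pmf (sig k w) i * pmf \<psi> w / (\<Sum>w'\<in>UNIV. pmf (sig k w') i * pmf \<psi> w')"

definition expected_payoff ::
    "('w::finite \<Rightarrow> real) \<Rightarrow> ('s \<Rightarrow> 'p \<Rightarrow> 'w \<Rightarrow> real) \<Rightarrow> 's \<Rightarrow> 'p \<Rightarrow> real" where
  "expected_payoff \<mu> u k p = (\<Sum>w\<in>UNIV. \<mu> w * u k p w)"

text \<open>
  Realizations of probability zero are exempt: they have no Bayesian posterior
  (\<open>posterior\<close> is then identically \<open>0\<close> because division by zero yields zero).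
\<close>

definition no_ties ::
    "'w::finite pmf \<Rightarrow> ('s \<Rightarrow> 'i set) \<Rightarrow> ('s \<Rightarrow> 'w \<Rightarrow> 'i pmf) \<Rightarrow>
     ('s \<Rightarrow> 'p \<Rightarrow> 'w \<Rightarrow> real) \<Rightarrow> bool" where
  "no_ties \<psi> I sig u \<longleftrightarrow>
     (\<forall>k. inj (expected_payoff (pmf \<psi>) u k) \<and>
          (\<forall>i\<in>I k. (\<Sum>w\<in>UNIV. pmf (sig k w) i * pmf \<psi> w) > 0 \<longrightarrow>
             inj (expected_payoff (posterior \<psi> sig k i) u k)))"

definition priority_rank :: "('p \<Rightarrow> ('s::finite \<times> 's) set) \<Rightarrow> 'p \<Rightarrow> 's \<Rightarrow> nat" where
  "priority_rank prio p k = 1 + card {s. (s, k) \<in> prio p}"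

definition choice_set ::
    "('p \<Rightarrow> ('s::finite \<times> 's) set) \<Rightarrow> 's \<Rightarrow> ('p \<Rightarrow> nat) \<Rightarrow> 'p set" where
  "choice_set prio k c = {p. priority_rank prio p k \<le> c p}"

definition cutoff_prob :: "('p::finite \<Rightarrow> real) \<Rightarrow> ('p \<Rightarrow> nat) \<Rightarrow> real" where
  "cutoff_prob b c = (\<Prod>p\<in>UNIV. max 0 (1 - \<bar>b p - real (c p)\<bar>))"

text \<open>
  The maximizer over a nonempty \<open>C\<close> is unique under \<open>no_ties\<close>, except at realizations of
  probability zero, which do not affect \<open>welfare\<close>.
\<close>

definition decision ::
    "'w::finite pmf \<Rightarrow> ('s \<Rightarrow> 'w \<Rightarrow> 'i pmf) \<Rightarrow> ('s \<Rightarrow> 'p \<Rightarrow> 'w \<Rightarrow> real) \<Rightarrow>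
     's \<Rightarrow> 'p set \<Rightarrow> 'i \<Rightarrow> 'p" where
  "decision \<psi> sig u k C i = arg_max_on (expected_payoff (posterior \<psi> sig k i) u k) C"

text \<open>
  Leaving out the cutoffs with an empty choice set gives being unassigned the value \<open>0\<close>.
  The outer sum ranges over an infinite set, but only finitely many cutoffs have positive
  probability.
\<close>

definition welfare ::
    "('p::finite \<Rightarrow> ('s::finite \<times> 's) set) \<Rightarrow> 'w::finite pmf \<Rightarrow> ('s \<Rightarrow> 'p \<Rightarrow> 'w \<Rightarrow> real) \<Rightarrow>
     ('s \<Rightarrow> 'i set) \<Rightarrow> ('s \<Rightarrow> 'w \<Rightarrow> 'i pmf) \<Rightarrow> 's \<Rightarrow> ('p \<Rightarrow> real) \<Rightarrow> real" where
  "welfare prio \<psi> u I sig k b =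
     (\<Sum>\<^sub>\<infinity>c | choice_set prio k c \<noteq> {}. \<Sum>i\<in>I k. \<Sum>w\<in>UNIV.
        cutoff_prob b c * pmf \<psi> w * pmf (sig k w) i *
        u k (decision \<psi> sig u k (choice_set prio k c) i) w)"

text \<open>
  A negative prior expected payoff makes a program worse than being unassigned, so a student for
  whom \<open>may_be_unassigned\<close> holds could lose from a higher cutoff that only adds such a program.
\<close>

definition may_be_unassigned ::
    "('p::finite \<Rightarrow> ('s::finite \<times> 's) set) \<Rightarrow> 's \<Rightarrow> ('p \<Rightarrow> real) \<Rightarrow> bool" where
  "may_be_unassigned prio k b \<longleftrightarrow> (\<exists>c. cutoff_prob b c > 0 \<and> choice_set prio k c = {})"

end

theory Submission
  imports Defs
begin

text \<open>
  The expectation of \<open>g\<close> under the one-dimensional rounding of \<open>x\<close> is the piecewise linear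
  interpolation of \<open>g\<close> at \<open>x\<close>, so it increases with \<open>x\<close> if \<open>g\<close> is monotone. Integrating out one
  coordinate at a time extends this to products: expectations of monotone functions of the cutoff
  increase with the ex-ante cutoff. The value of a choice set is monotone on nonempty sets, since
  the decision maximizes the posterior expected payoff. The empty set gets value \<open>0\<close> if it can
  occur under \<open>b'\<close> (every program is then acceptable). Otherwise it cannot occur under \<open>b\<close> either,
  and its value may be replaced by the smallest value of all sets.
\<close>

section \<open>Optimal decisions and the value of a choice set\<close>

lemma decision_optimal:
  fixes C :: "'p::finite set"
  assumes "C \<noteq> {}"
  shows "decision \<psi> sig u k C i \<in> C"
    and "p \<in> C \<Longrightarrow> expected_payoff (posterior \<psi> sig k i) u k p
      \<le> expected_payoff (posterior \<psi> sig k i) u k (decision \<psi> sig u k C i)"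
proof -
  let ?f = "expected_payoff (posterior \<psi> sig k i) u k"
  \<comment> \<open>There are finitely many programs, so the maximum is attained;
    \<open>arg_max_on\<close> is a choice operator and needs this witness to be a maximizer.\<close>
  have "Max (?f ` C) \<in> ?f ` C"
    using assms by (intro Max_in) auto
  then obtain q where q: "q \<in> C" "?f q = Max (?f ` C)"
    by auto
  have "decision \<psi> sig u k C i \<in> C \<and> (\<forall>p\<in>C. ?f p \<le> ?f (decision \<psi> sig u k C i))"
    unfolding decision_def arg_max_on_def
  proof (rule arg_maxI[where x = q])
    show "\<not> ?f q < ?f y" if "y \<in> C" for y
      using that q by (simp add: not_less)
  qed (use q in \<open>auto simp: not_less\<close>)
  then show "decision \<psi> sig u k C i \<in> C"
    and "p \<in> C \<Longrightarrow> ?f p \<le> ?f (decision \<psi> sig u k C i)"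
    by auto
qed

text \<open>Bayes' rule with the denominator cleared. If the realization \<open>i\<close> has
  probability zero, every joint probability vanishes, so both sides are \<open>0\<close> whatever
  value the formal posterior takes.\<close>

lemma joint_payoff_eq_posterior:
  "(\<Sum>w\<in>UNIV. pmf \<psi> w * pmf (sig k w) i * u k p w)
    = (\<Sum>w\<in>UNIV. pmf (sig k w) i * pmf \<psi> w) * expected_payoff (posterior \<psi> sig k i) u k p"
proof (cases "(\<Sum>w\<in>UNIV. pmf (sig k w) i * pmf \<psi> w) = 0")
  case True
  then have "pmf (sig k w) i * pmf \<psi> w = 0" for w
    by (subst (asm) sum_nonneg_eq_0_iff) auto
  then have "pmf \<psi> w * pmf (sig k w) i * u k p w = 0" for w
    by (metis mult.commute mult_zero_left)
  then show ?thesis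
    using True by (simp only: sum.neutral_const mult_zero_left)
next
  case False
  then show ?thesis
    unfolding expected_payoff_def posterior_def sum_distrib_left
    by (intro sum.cong) (simp_all add: field_simps)
qed

text \<open>The ex-ante value of a fixed choice set; welfare is its expectation over the cutoffs
  with nonempty choice set. At the empty set the decision, and hence this value, is
  arbitrary.\<close>

definition choice_value ::
    "'w::finite pmf \<Rightarrow> ('s \<Rightarrow> 'p \<Rightarrow> 'w \<Rightarrow> real) \<Rightarrow> ('s \<Rightarrow> 'i set) \<Rightarrow> ('s \<Rightarrow> 'w \<Rightarrow> 'i pmf) \<Rightarrow>
     's \<Rightarrow> 'p set \<Rightarrow> real" where
  "choice_value \<psi> u I sig k C =
     (\<Sum>i\<in>I k. \<Sum>w\<in>UNIV. pmf \<psi> w * pmf (sig k w) i * u k (decision \<psi> sig u k C i) w)"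

lemma joint_payoff_le_decision:
  fixes C :: "'p::finite set"
  assumes "p \<in> C"
  shows "(\<Sum>w\<in>UNIV. pmf \<psi> w * pmf (sig k w) i * u k p w)
    \<le> (\<Sum>w\<in>UNIV. pmf \<psi> w * pmf (sig k w) i * u k (decision \<psi> sig u k C i) w)"
  unfolding joint_payoff_eq_posterior
  using assms by (intro mult_left_mono sum_nonneg decision_optimal(2)) auto

text \<open>The program chosen from \<open>C\<close> is still available in \<open>D\<close>, where
  the decision does at least as well at every realization.\<close>

lemma choice_value_mono:
  fixes C :: "'p::finite set"
  assumes "C \<noteq> {}" "C \<subseteq> D"
  shows "choice_value \<psi> u I sig k C \<le> choice_value \<psi> u I sig k D"
  unfolding choice_value_def
  by (intro sum_mono joint_payoff_le_decision subsetD[OF assms(2)] decision_optimal(1) assms(1))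

text \<open>Ignoring the signal and always taking \<open>p\<close> yields its prior payoff, and
  deciding after each realization is at least as good. Acceptable programs thus give every nonempty
  set a value of at least \<open>0\<close>.\<close>

lemma choice_value_ge_prior:
  fixes C :: "'p::finite set"
  assumes "signal_profile I sig" "p \<in> C"
  shows "expected_payoff (pmf \<psi>) u k p \<le> choice_value \<psi> u I sig k C"
proof -
  have "(\<Sum>i\<in>I k. pmf (sig k w) i) = 1" for w
    using assms(1) by (intro sum_pmf_eq_1) (auto simp: signal_profile_def)
  then have "expected_payoff (pmf \<psi>) u k p
      = (\<Sum>w\<in>UNIV. \<Sum>i\<in>I k. pmf \<psi> w * pmf (sig k w) i * u k p w)"
    unfolding expected_payoff_def
    by (simp flip: sum_distrib_left sum_distrib_right)
  also have "\<dots> = (\<Sum>i\<in>I k. \<Sum>w\<in>UNIV. pmf \<psi> w * pmf (sig k w) i * u k p w)"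
    by (rule sum.swap)
  also have "\<dots> \<le> choice_value \<psi> u I sig k C"
    unfolding choice_value_def using assms(2)
    by (intro sum_mono joint_payoff_le_decision)
  finally show ?thesis .
qed

section \<open>Rounding a single coordinate\<close>

text \<open>At most the integers \<open>m\<close> and \<open>Suc m\<close> carry weight;
  \<open>m < N\<close> keeps \<open>Suc m\<close> inside the range of summation.\<close>

lemma tent_sum_eq_interpolation:
  fixes g :: "nat \<Rightarrow> real"
  assumes "real m \<le> x" "x < real m + 1" "m < N"
  shows "(\<Sum>j\<le>N. max 0 (1 - \<bar>x - real j\<bar>) * g j)
    = (1 - (x - real m)) * g m + (x - real m) * g (Suc m)"
proof -
  have "(\<Sum>j\<le>N. max 0 (1 - \<bar>x - real j\<bar>) * g j)
      = (\<Sum>j\<in>{m, Suc m}. max 0 (1 - \<bar>x - real j\<bar>) * g j)"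
  proof (rule sum.mono_neutral_right)
    show "\<forall>j\<in>{..N} - {m, Suc m}. max 0 (1 - \<bar>x - real j\<bar>) * g j = 0"
    proof
      fix j assume "j \<in> {..N} - {m, Suc m}"
      then consider "j + 1 \<le> m" | "m + 2 \<le> j"
        by fastforce
      then have "1 - \<bar>x - real j\<bar> \<le> 0"
        using assms by cases auto
      then show "max 0 (1 - \<bar>x - real j\<bar>) * g j = 0"
        by simp
    qed
  qed (use assms in auto)
  then show ?thesis
    using assms by (simp add: max_def abs_if)
qed

lemma tent_sum_mono:
  fixes g :: "nat \<Rightarrow> real"
  assumes "mono g" "0 \<le> x" "x \<le> y" "y < real N"
  shows "(\<Sum>j\<le>N. max 0 (1 - \<bar>x - real j\<bar>) * g j) \<le> (\<Sum>j\<le>N. max 0 (1 - \<bar>y - real j\<bar>) * g j)"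
proof -
  define m n where "m = nat \<lfloor>x\<rfloor>" and "n = nat \<lfloor>y\<rfloor>"
  have m: "real m \<le> x" "x < real m + 1" and n: "real n \<le> y" "y < real n + 1"
    using assms by (auto simp: m_def n_def)
  have "m < N" "n < N"
    using m n assms by linarith+
  note interp = tent_sum_eq_interpolation[OF m this(1)] tent_sum_eq_interpolation[OF n this(2)]
  have inc: "g i \<le> g (Suc i)" for i
    using assms(1) by (simp add: monoD)
  have "m \<le> n"
    unfolding m_def n_def using assms by (intro nat_mono floor_mono)
  show ?thesis
  \<comment> \<open>Within one unit interval the interpolation is linear with slope
    \<open>g (Suc m) - g m\<close>. Otherwise the integers \<open>Suc m\<close> and \<open>n\<close>
    separate \<open>x\<close> from \<open>y\<close>.\<close>
  proof (cases "m = n")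
    case True
    have "(y - x) * g m \<le> (y - x) * g (Suc m)"
      using inc assms by (intro mult_left_mono) auto
    then show ?thesis
      unfolding interp using True by (simp add: algebra_simps)
  next
    case False
    have "(1 - (x - real m)) * g m + (x - real m) * g (Suc m) \<le> g (Suc m)"
      using mult_left_mono[OF inc[of m], of "1 - (x - real m)"] m by (simp add: algebra_simps)
    also have "\<dots> \<le> g n"
      using False \<open>m \<le> n\<close> assms(1) by (intro monoD[OF assms(1)]) auto
    also have "\<dots> \<le> (1 - (y - real n)) * g n + (y - real n) * g (Suc n)"
      using mult_left_mono[OF inc[of n], of "y - real n"] n by (simp add: algebra_simps)
    finally show ?thesis
      unfolding interp .
  qed
qed

section \<open>Stochastic dominance for products\<close>

lemma sum_prod_dominance:
  fixes v w :: "'a \<Rightarrow> 'b::order \<Rightarrow> real" and G :: "('a \<Rightarrow> 'b) \<Rightarrow> real"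
  assumes "finite A"
    and "\<And>p j. 0 \<le> v p j" "\<And>p j. 0 \<le> w p j"
    and dom: "\<And>p g. mono g \<Longrightarrow> (\<Sum>j\<in>B. v p j * g j) \<le> (\<Sum>j\<in>B. w p j * g j)"
    and "mono G"
  shows "(\<Sum>c\<in>PiE A (\<lambda>_. B). (\<Prod>p\<in>A. v p (c p)) * G c)
    \<le> (\<Sum>c\<in>PiE A (\<lambda>_. B). (\<Prod>p\<in>A. w p (c p)) * G c)"
  using assms(1,5)
proof (induction A arbitrary: G rule: finite_induct)
  case empty
  then show ?case by simp
next
  case (insert x A)
  \<comment> \<open>Coordinate \<open>x\<close> becomes an inner sum; \<open>t\<close> stands for
    both \<open>v\<close> and \<open>w\<close>.\<close>
  have split: "(\<Sum>c\<in>PiE (insert x A) (\<lambda>_. B). (\<Prod>p\<in>insert x A. t p (c p)) * G c)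
      = (\<Sum>c\<in>PiE A (\<lambda>_. B). (\<Prod>p\<in>A. t p (c p)) * (\<Sum>j\<in>B. t x j * G (c(x := j))))"
    for t :: "'a \<Rightarrow> 'b \<Rightarrow> real"
  proof -
    have "(\<Sum>c\<in>PiE (insert x A) (\<lambda>_. B). (\<Prod>p\<in>insert x A. t p (c p)) * G c)
        = (\<Sum>(j, c)\<in>B \<times> PiE A (\<lambda>_. B).
            (\<Prod>p\<in>insert x A. t p ((c(x := j)) p)) * G (c(x := j)))"
      unfolding PiE_insert_eq
      by (subst sum.reindex[OF inj_combinator[OF insert.hyps(2)]]) (simp add: case_prod_unfold)
    also have "\<dots> = (\<Sum>(j, c)\<in>B \<times> PiE A (\<lambda>_. B).
        (\<Prod>p\<in>A. t p (c p)) * (t x j * G (c(x := j))))"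
    proof (intro sum.cong refl, clarify)
      fix j c
      have "(\<Prod>p\<in>A. t p ((c(x := j)) p)) = (\<Prod>p\<in>A. t p (c p))"
        using insert.hyps(2) by (intro prod.cong) auto
      then show "(\<Prod>p\<in>insert x A. t p ((c(x := j)) p)) * G (c(x := j))
          = (\<Prod>p\<in>A. t p (c p)) * (t x j * G (c(x := j)))"
        using insert.hyps by simp
    qed
    also have "\<dots> = (\<Sum>c\<in>PiE A (\<lambda>_. B). (\<Prod>p\<in>A. t p (c p)) * (\<Sum>j\<in>B. t x j * G (c(x := j))))"
      by (simp add: sum.cartesian_product[symmetric] sum_distrib_left) (rule sum.swap)
    finally show ?thesis .
  qed
  have "mono (\<lambda>j. G (c(x := j)))" for c
    by (intro monoI monoD[OF insert.prems]) (auto simp: le_fun_def)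
  note step = dom[OF this]
  \<comment> \<open>Averaging over coordinate \<open>x\<close> with nonnegative weights leaves a
    monotone function of the others. So the weights can change from \<open>v\<close> to
    \<open>w\<close> first at \<open>x\<close>, then on \<open>A\<close> by induction.\<close>
  have *: "mono (\<lambda>c. \<Sum>j\<in>B. w x j * G (c(x := j)))"
    by (intro monoI sum_mono mult_left_mono monoD[OF insert.prems] assms(3))
      (auto simp: le_fun_def)
  have "(\<Sum>c\<in>PiE A (\<lambda>_. B). (\<Prod>p\<in>A. v p (c p)) * (\<Sum>j\<in>B. v x j * G (c(x := j))))
      \<le> (\<Sum>c\<in>PiE A (\<lambda>_. B). (\<Prod>p\<in>A. v p (c p)) * (\<Sum>j\<in>B. w x j * G (c(x := j))))"
    by (intro sum_mono mult_left_mono step prod_nonneg) (auto simp: assms(2))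
  also have "\<dots> \<le> (\<Sum>c\<in>PiE A (\<lambda>_. B). (\<Prod>p\<in>A. w p (c p)) * (\<Sum>j\<in>B. w x j * G (c(x := j))))"
    by (rule insert.IH[OF *])
  finally show ?case
    unfolding split .
qed

lemma cutoff_expectation_mono:
  fixes G :: "('p::finite \<Rightarrow> nat) \<Rightarrow> real"
  assumes "mono G" "\<And>p. 0 \<le> b' p" "\<And>p. b' p \<le> b p" "\<And>p. b p < real N"
  shows "(\<Sum>c\<in>PiE UNIV (\<lambda>_. {..N}). cutoff_prob b' c * G c)
    \<le> (\<Sum>c\<in>PiE UNIV (\<lambda>_. {..N}). cutoff_prob b c * G c)"
  unfolding cutoff_prob_def
  by (rule sum_prod_dominance[where v = "\<lambda>p j. max 0 (1 - \<bar>b' p - real j\<bar>)"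
        and w = "\<lambda>p j. max 0 (1 - \<bar>b p - real j\<bar>)"])
    (auto intro!: tent_sum_mono assms)

section \<open>Possible cutoffs and welfare as a finite sum\<close>

lemma cutoff_prob_nonneg: "0 \<le> cutoff_prob b c"
  unfolding cutoff_prob_def by (intro prod_nonneg) auto

lemma cutoff_prob_pos_iff: "0 < cutoff_prob b c \<longleftrightarrow> (\<forall>p. \<bar>b p - real (c p)\<bar> < 1)"
proof
  assume "0 < cutoff_prob b c"
  then have "max 0 (1 - \<bar>b p - real (c p)\<bar>) \<noteq> 0" for p
    unfolding cutoff_prob_def using prod_zero[of UNIV "\<lambda>p. max 0 (1 - \<bar>b p - real (c p)\<bar>)"]
    by (metis UNIV_I finite less_irrefl)
  then have "\<bar>b p - real (c p)\<bar> < 1" for p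
    by (metis diff_gt_0_iff_gt max.absorb1 not_less)
  then show "\<forall>p. \<bar>b p - real (c p)\<bar> < 1" ..
next
  assume "\<forall>p. \<bar>b p - real (c p)\<bar> < 1"
  then show "0 < cutoff_prob b c"
    unfolding cutoff_prob_def by (intro prod_pos) auto
qed

lemma choice_set_mono: "c \<le> d \<Longrightarrow> choice_set prio k c \<subseteq> choice_set prio k d"
  by (auto simp: choice_set_def le_fun_def intro: order_trans)

lemma may_be_unassigned_antimono:
  fixes b b' :: "'p::finite \<Rightarrow> real"
  assumes "may_be_unassigned prio k b" "\<And>p. 0 \<le> b' p" "\<And>p. b' p \<le> b p"
  shows "may_be_unassigned prio k b'"
proof -
  obtain c where c: "0 < cutoff_prob b c" "choice_set prio k c = {}"
    using assms(1) by (auto simp: may_be_unassigned_def)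
  \<comment> \<open>Capping \<open>c\<close> at the integer part of \<open>b' p\<close> keeps the
    choice set empty. The cap is within distance 1 of \<open>b' p\<close>; where \<open>c p\<close>
    lies below it, \<open>b' p - c p \<le> b p - c p < 1\<close>.\<close>
  define c' where "c' p = min (c p) (nat \<lfloor>b' p\<rfloor>)" for p
  have "\<bar>b' p - real (c' p)\<bar> < 1" for p
  proof -
    have "\<bar>b p - real (c p)\<bar> < 1"
      using c(1) by (simp add: cutoff_prob_pos_iff)
    moreover obtain m where m: "m = nat \<lfloor>b' p\<rfloor>"
      by blast
    moreover have "real m \<le> b' p" "b' p < real m + 1"
      using assms(2)[of p] by (auto simp: m)
    ultimately show ?thesis
      using assms(3)[of p] unfolding c'_def m[symmetric] min_def
      by (simp add: abs_less_iff split: if_splits)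
  qed
  moreover have "choice_set prio k c' \<subseteq> choice_set prio k c"
    by (intro choice_set_mono) (auto simp: c'_def le_fun_def)
  ultimately show ?thesis
    using c(2) unfolding may_be_unassigned_def cutoff_prob_pos_iff by blast
qed

text \<open>
  The value \<open>L\<close> of being unassigned can be chosen freely if that event has probability zero.
\<close>

lemma welfare_eq_sum:
  fixes b :: "'p::finite \<Rightarrow> real"
  assumes "\<And>p. b p < real N"
    and "may_be_unassigned prio k b \<Longrightarrow> L = 0"
  shows "welfare prio \<psi> u I sig k b = (\<Sum>c\<in>PiE UNIV (\<lambda>_. {..N}). cutoff_prob b c *
      (if choice_set prio k c = {} then L else choice_value \<psi> u I sig k (choice_set prio k c)))"
    (is "_ = (\<Sum>c\<in>?B. cutoff_prob b c * ?G c)")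
proof -
  \<comment> \<open>Some coordinate is at least \<open>N + 1\<close>, which exceeds
    \<open>b p\<close> by more than 1, so its factor is zero.\<close>
  have outside: "cutoff_prob b c = 0" if c: "c \<notin> ?B" for c
  proof -
    obtain p where "N < c p"
      using c by (auto simp: PiE_iff not_le)
    then have "\<not> 0 < cutoff_prob b c"
      using assms(1)[of p] by (auto simp: cutoff_prob_pos_iff not_less intro!: exI[of _ p])
    then show ?thesis
      using cutoff_prob_nonneg[of b c] by simp
  qed
  have unassigned: "cutoff_prob b c * L = 0" if "choice_set prio k c = {}" for c
    using assms(2) that cutoff_prob_nonneg[of b c] unfolding may_be_unassigned_def
    by (metis less_eq_real_def mult_eq_0_iff)
  have "welfare prio \<psi> u I sig k b = (\<Sum>\<^sub>\<infinity>c | choice_set prio k c \<noteq> {}.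
      cutoff_prob b c * choice_value \<psi> u I sig k (choice_set prio k c))"
    unfolding welfare_def choice_value_def by (simp add: sum_distrib_left mult.assoc)
  \<comment> \<open>The index sets differ only in cutoffs outside the box, which have weight zero,
    and cutoffs with empty choice set, where the term with \<open>L\<close> vanishes.\<close>
  also have "\<dots> = (\<Sum>\<^sub>\<infinity>c\<in>?B. cutoff_prob b c * ?G c)"
    by (rule infsum_cong_neutral) (auto simp: outside unassigned)
  also have "\<dots> = (\<Sum>c\<in>?B. cutoff_prob b c * ?G c)"
    by (intro infsum_finite finite_PiE) auto
  finally show ?thesis .
qed

theorem proposition4p3:
  fixes prio :: "'p::finite \<Rightarrow> ('s::finite \<times> 's) set"
    and pref :: "'s \<Rightarrow> 'w::finite \<Rightarrow> ('p \<times> 'p) set"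
    and u :: "'s \<Rightarrow> 'p \<Rightarrow> 'w \<Rightarrow> real"
    and \<psi> :: "'w pmf"
    and I :: "'s \<Rightarrow> 'i set"
    and sig :: "'s \<Rightarrow> 'w \<Rightarrow> 'i pmf"
    and b b' :: "'p \<Rightarrow> real"
    and k :: 's
  assumes market: "matching_market prio pref u"
    and signals: "signal_profile I sig"
    and no_ties: "no_ties \<psi> I sig u"
    and b_nonneg: "\<And>p. 0 \<le> b p"
    and b'_nonneg: "\<And>p. 0 \<le> b' p"
    and b_ge: "\<And>p. b p \<ge> b' p"
    and acceptable: "\<And>p. may_be_unassigned prio k b' \<Longrightarrow> 0 \<le> expected_payoff (pmf \<psi>) u k p"
  shows "welfare prio \<psi> u I sig k b \<ge> welfare prio \<psi> u I sig k b'"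
proof -
  define L where "L = (if may_be_unassigned prio k b' then 0
    else Min (range (choice_value \<psi> u I sig k)))"
  let ?G = "\<lambda>c. if choice_set prio k c = {} then L
    else choice_value \<psi> u I sig k (choice_set prio k c)"
  have L_le: "L \<le> choice_value \<psi> u I sig k C" if C: "C \<noteq> {}" for C
  proof (cases "may_be_unassigned prio k b'")
    case True
    obtain p where "p \<in> C"
      using C by blast
    then show ?thesis
      using acceptable[OF True, of p] choice_value_ge_prior[OF signals, of p C \<psi> u k] True
      by (simp add: L_def)
  \<comment> \<open>There are finitely many sets of programs, so \<open>Min\<close> is a lower bound
    of all their values.\<close>
  qed (simp add: L_def)
  have "mono ?G"
  proof (rule monoI)
    fix c d :: "'p \<Rightarrow> nat"
    assume "c \<le> d"
    then have "choice_set prio k c \<subseteq> choice_set prio k d"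
      by (rule choice_set_mono)
    then show "?G c \<le> ?G d"
      using L_le[of "choice_set prio k d"]
        choice_value_mono[of "choice_set prio k c" "choice_set prio k d" \<psi> u I sig k]
      by auto
  qed
  \<comment> \<open>An \<open>N\<close> above all entries of \<open>b\<close> also bounds
    \<open>b'\<close>, so both welfare sums run over the same box.\<close>
  obtain N where "Max (range b) < real N"
    using reals_Archimedean2 by blast
  then have N: "b p < real N" for p
    by simp
  then have N': "b' p < real N" for p
    using b_ge order_le_less_trans by blast
  have "welfare prio \<psi> u I sig k b' = (\<Sum>c\<in>PiE UNIV (\<lambda>_. {..N}). cutoff_prob b' c * ?G c)"
    by (rule welfare_eq_sum) (auto simp: N' L_def)
  also have "\<dots> \<le> (\<Sum>c\<in>PiE UNIV (\<lambda>_. {..N}). cutoff_prob b c * ?G c)"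
    by (rule cutoff_expectation_mono[OF \<open>mono ?G\<close> b'_nonneg b_ge N])
  \<comment> \<open>If being unassigned is possible under \<open>b\<close>, it is possible under
    \<open>b'\<close>, and then \<open>L = 0\<close> as the finite sum requires.\<close>
  also have "\<dots> = welfare prio \<psi> u I sig k b"
    by (rule welfare_eq_sum[symmetric])
      (use may_be_unassigned_antimono[of prio k b b'] b'_nonneg b_ge in \<open>auto simp: N L_def\<close>)
  finally show ?thesis .
qed

end
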